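(* Let $\alpha=(A,(A_i)_{i\in I_\alpha})$ and $\beta=(B,(B_i)_{i\in I_\beta})$ be coset incidence systems, and let $\varphi:B\to\mathrm{Aut}(A)$ be an admissible action. If $A$ is flag-transitive on $\alpha$ and $B$ is flag-transitive on $\beta$, then $G=A\rtimes_\varphi B$ is flag-transitive on the semi-direct product $\alpha\rtimes_\varphi\beta$.
   Context: A coset incidence system $(G,(G_i)_{i\in I})$ consists of a group $G$ and a family of subgroups $G_i\le G$ indexed by a type set $I$. It denotes the incidence system whose elements of type $i$ are the left cosets $gG_i$ (cosets of different types are regarded as different elements), two elements being incident iff their intersection is non-empty. A flag is a set of pairwise incident elements; its type is the set of types of its elements. $G$ acts by left multiplication and is flag-transitive if for every $J\subseteq I$ it is transitive on the flags of type $J$. A homomorphism $\varphi:B\to\mathrm{Aut}(A)$ is admissible if it permutes the family $(A_i)_{i\in I_\alpha}$; then $B$ acts on $I_\alpha$ by $i^b=j$ iff $\varphi(b)(A_i)=A_j$. Let $K$ be the set of orbits of $B$ on $I_\alpha$. For an orbit $k\in K$ put $A_k=\bigcap_{i\in k}A_i$. Semi-direct product: $\alpha\rtimes_\varphi\beta=(G,(G_i)_{i\in I})$ with $G=A\rtimes_\varphi B$, $I=I_\beta\sqcup K$ (disjoint union), $G_i=\langle A,B_i\rangle\cong A\rtimes B_i$ if $i\in I_\beta$ and $G_i=\langle A_i,B\rangle\cong A_i\rtimes B$ if $i\in K$. *)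

theory Defs
  imports "HOL-Algebra.Left_Coset" "HOL-Algebra.Group_Action" "HOL-Algebra.Generated_Groups"
begin

section \<open>Coset incidence systems\<close>

record ('g, 'i) coset_system =
  grp :: "'g monoid"
  types :: "'i set"
  sub :: "'i \<Rightarrow> 'g set"

definition coset_incidence_system :: "('g, 'i) coset_system \<Rightarrow> bool" where
  "coset_incidence_system \<alpha> \<longleftrightarrow>
     group (grp \<alpha>) \<and> (\<forall>i \<in> types \<alpha>. subgroup (sub \<alpha> i) (grp \<alpha>))"

text \<open>
  An element carries its type as first component, so that equal cosets of different types are
  different elements.
\<close>

definition elements :: "('g, 'i) coset_system \<Rightarrow> ('i \<times> 'g set) set" where
  "elements \<alpha> = (SIGMA i : types \<alpha>. lcosets\<^bsub>grp \<alpha>\<^esub> (sub \<alpha> i))"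

definition incident :: "'i \<times> 'g set \<Rightarrow> 'i \<times> 'g set \<Rightarrow> bool" where
  "incident x y \<longleftrightarrow> snd x \<inter> snd y \<noteq> {}"

definition flag :: "('g, 'i) coset_system \<Rightarrow> ('i \<times> 'g set) set \<Rightarrow> bool" where
  "flag \<alpha> F \<longleftrightarrow> F \<subseteq> elements \<alpha> \<and> (\<forall>x \<in> F. \<forall>y \<in> F. incident x y)"

definition flag_type :: "('i \<times> 'g set) set \<Rightarrow> 'i set" where
  "flag_type F = fst ` F"

definition translate :: "('g, 'i) coset_system \<Rightarrow> 'g \<Rightarrow> 'i \<times> 'g set \<Rightarrow> 'i \<times> 'g set" where
  "translate \<alpha> g x = (fst x, g <#\<^bsub>grp \<alpha>\<^esub> snd x)"

definition flag_transitive :: "('g, 'i) coset_system \<Rightarrow> bool" where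
  "flag_transitive \<alpha> \<longleftrightarrow>
     (\<forall>J \<subseteq> types \<alpha>. \<forall>F F'.
        flag \<alpha> F \<and> flag_type F = J \<and> flag \<alpha> F' \<and> flag_type F' = J \<longrightarrow>
        (\<exists>g \<in> carrier (grp \<alpha>). translate \<alpha> g ` F = F'))"


section \<open>Admissible actions and semi-direct products\<close>

definition admissible :: "('a, 'i) coset_system \<Rightarrow> 'b monoid \<Rightarrow> ('b \<Rightarrow> 'a \<Rightarrow> 'a) \<Rightarrow> bool" where
  "admissible \<alpha> B \<phi> \<longleftrightarrow>
     \<phi> \<in> hom B (AutoGroup (grp \<alpha>)) \<and>
     (\<forall>b \<in> carrier B. \<exists>\<sigma>. bij_betw \<sigma> (types \<alpha>) (types \<alpha>) \<and>
        (\<forall>i \<in> types \<alpha>. \<phi> b ` sub \<alpha> i = sub \<alpha> (\<sigma> i)))"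

text \<open>
  The orbit of \<open>i\<close> under the induced action on types, where \<open>b\<close> sends \<open>i\<close> to \<open>j\<close> iff
  \<open>\<phi>(b)(A\<^sub>i) = A\<^sub>j\<close>. Stated as a relation, this makes sense without assuming that the
  subgroups \<open>A\<^sub>i\<close> are pairwise distinct; whenever the rule does define an action, the
  orbits are those of that action (see \<open>type_orbits_eq_orbits\<close>).
\<close>

definition type_orbit ::
    "('a, 'i) coset_system \<Rightarrow> 'b monoid \<Rightarrow> ('b \<Rightarrow> 'a \<Rightarrow> 'a) \<Rightarrow> 'i \<Rightarrow> 'i set" where
  "type_orbit \<alpha> B \<phi> i = {j \<in> types \<alpha>. \<exists>b \<in> carrier B. \<phi> b ` sub \<alpha> i = sub \<alpha> j}"

definition type_orbits ::
    "('a, 'i) coset_system \<Rightarrow> 'b monoid \<Rightarrow> ('b \<Rightarrow> 'a \<Rightarrow> 'a) \<Rightarrow> 'i set set" where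
  "type_orbits \<alpha> B \<phi> = type_orbit \<alpha> B \<phi> ` types \<alpha>"

definition orbit_sub :: "('a, 'i) coset_system \<Rightarrow> 'i set \<Rightarrow> 'a set" where
  "orbit_sub \<alpha> k = (\<Inter>i \<in> k. sub \<alpha> i)"

definition semidirect_group ::
    "'a monoid \<Rightarrow> 'b monoid \<Rightarrow> ('b \<Rightarrow> 'a \<Rightarrow> 'a) \<Rightarrow> ('a \<times> 'b) monoid" where
  "semidirect_group A B \<phi> =
     \<lparr>carrier = carrier A \<times> carrier B,
      mult = (\<lambda>(a, b) (a', b'). (a \<otimes>\<^bsub>A\<^esub> \<phi> b a', b \<otimes>\<^bsub>B\<^esub> b')),
      one = (\<one>\<^bsub>A\<^esub>, \<one>\<^bsub>B\<^esub>)\<rparr>"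

text \<open>
  \<open>A\<close> and \<open>B\<close> are identified with their canonical copies \<open>A \<times> {1}\<close> and \<open>{1} \<times> B\<close> in the
  semi-direct product.
\<close>

definition semidirect_product ::
    "('a, 'i) coset_system \<Rightarrow> ('b, 'j) coset_system \<Rightarrow> ('b \<Rightarrow> 'a \<Rightarrow> 'a) \<Rightarrow>
     ('a \<times> 'b, 'j + 'i set) coset_system" where
  "semidirect_product \<alpha> \<beta> \<phi> =
    (let A = grp \<alpha>; B = grp \<beta>; G = semidirect_group A B \<phi> in
     \<lparr>grp = G,
      types = types \<beta> <+> type_orbits \<alpha> B \<phi>,
      sub = (\<lambda>t. case t of
          Inl i \<Rightarrow> generate G (carrier A \<times> {\<one>\<^bsub>B\<^esub>} \<union> {\<one>\<^bsub>A\<^esub>} \<times> sub \<beta> i)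
        | Inr k \<Rightarrow> generate G (orbit_sub \<alpha> k \<times> {\<one>\<^bsub>B\<^esub>} \<union> {\<one>\<^bsub>A\<^esub>} \<times> carrier B))\<rparr>)"


section \<open>Well-definedness\<close>

lemma type_orbits_eq_orbits:
  assumes "\<And>b i. b \<in> carrier B \<Longrightarrow> i \<in> types \<alpha> \<Longrightarrow> \<psi> b i \<in> types \<alpha>"
    and "\<And>b i j. b \<in> carrier B \<Longrightarrow> i \<in> types \<alpha> \<Longrightarrow> j \<in> types \<alpha> \<Longrightarrow>
           \<psi> b i = j \<longleftrightarrow> \<phi> b ` sub \<alpha> i = sub \<alpha> j"
  shows "type_orbits \<alpha> B \<phi> = orbits B (types \<alpha>) \<psi>"
proof -
  have "type_orbit \<alpha> B \<phi> i = orbit B \<psi> i" if "i \<in> types \<alpha>" for i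
  proof (rule Set.set_eqI)
    fix j
    have "\<psi> b i = j \<longleftrightarrow> \<phi> b ` sub \<alpha> i = sub \<alpha> j" if "b \<in> carrier B" "j \<in> types \<alpha>" for b
      using assms(2)[OF that(1) \<open>i \<in> types \<alpha>\<close> that(2)] .
    moreover have "j \<in> types \<alpha>" if "b \<in> carrier B" "\<psi> b i = j" for b
      using assms(1)[OF that(1) \<open>i \<in> types \<alpha>\<close>] that(2) by simp
    ultimately show "j \<in> type_orbit \<alpha> B \<phi> i \<longleftrightarrow> j \<in> orbit B \<psi> i"
      unfolding type_orbit_def orbit_def mem_Collect_eq by metis
  qed
  then show ?thesis
    unfolding type_orbits_def orbits_def by auto
qed

lemma auto_hom_apply:
  assumes "\<phi> \<in> hom B (AutoGroup A)"
  shows "\<And>b a. b \<in> carrier B \<Longrightarrow> a \<in> carrier A \<Longrightarrow> \<phi> b a \<in> carrier A"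
    and "\<And>b a a'. b \<in> carrier B \<Longrightarrow> a \<in> carrier A \<Longrightarrow> a' \<in> carrier A \<Longrightarrow>
           \<phi> b (a \<otimes>\<^bsub>A\<^esub> a') = \<phi> b a \<otimes>\<^bsub>A\<^esub> \<phi> b a'"
    and "\<And>b b' a. b \<in> carrier B \<Longrightarrow> b' \<in> carrier B \<Longrightarrow> a \<in> carrier A \<Longrightarrow>
           \<phi> (b \<otimes>\<^bsub>B\<^esub> b') a = \<phi> b (\<phi> b' a)"
proof -
  have aut: "\<phi> b \<in> auto A" if "b \<in> carrier B" for b
    using assms that by (auto simp: hom_def AutoGroup_def BijGroup_def)
  then show "\<phi> b a \<in> carrier A" if "b \<in> carrier B" "a \<in> carrier A" for b a
    using that by (auto simp: auto_def hom_def)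
  show "\<phi> b (a \<otimes>\<^bsub>A\<^esub> a') = \<phi> b a \<otimes>\<^bsub>A\<^esub> \<phi> b a'"
    if "b \<in> carrier B" "a \<in> carrier A" "a' \<in> carrier A" for b a a'
    using aut that by (auto simp: auto_def hom_def)
  show "\<phi> (b \<otimes>\<^bsub>B\<^esub> b') a = \<phi> b (\<phi> b' a)"
    if "b \<in> carrier B" "b' \<in> carrier B" "a \<in> carrier A" for b b' a
  proof -
    have "\<phi> (b \<otimes>\<^bsub>B\<^esub> b') = \<phi> b \<otimes>\<^bsub>AutoGroup A\<^esub> \<phi> b'"
      using assms that by (auto simp: hom_def)
    also have "\<dots> = compose (carrier A) (\<phi> b) (\<phi> b')"
      using aut[OF that(1)] aut[OF that(2)] by (simp add: AutoGroup_def BijGroup_def auto_def)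
    finally show ?thesis
      using that by (simp add: compose_eq)
  qed
qed

lemma group_semidirect_group:
  assumes "group A" "group B" and \<phi>: "\<phi> \<in> hom B (AutoGroup A)"
  shows "group (semidirect_group A B \<phi>)"
proof -
  interpret A: group A by fact
  interpret B: group B by fact
  note ap = auto_hom_apply[OF \<phi>]
  have one_A: "\<phi> b \<one>\<^bsub>A\<^esub> = \<one>\<^bsub>A\<^esub>" if "b \<in> carrier B" for b
    using ap(2)[OF that A.one_closed A.one_closed] ap(1)[OF that A.one_closed] by simp
  have "group_hom B (AutoGroup A) \<phi>"
    by (simp add: group_hom_def group_hom_axioms_def \<phi> A.AutoGroup B.group_axioms)
  then have "\<phi> \<one>\<^bsub>B\<^esub> = \<one>\<^bsub>AutoGroup A\<^esub>"
    by (rule group_hom.hom_one)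
  then have one_B: "\<phi> \<one>\<^bsub>B\<^esub> a = a" if "a \<in> carrier A" for a
    using that by (simp add: AutoGroup_def BijGroup_def)
  show ?thesis
  proof (rule groupI)
    fix x assume x: "x \<in> carrier (semidirect_group A B \<phi>)"
    obtain a b where ab: "x = (a, b)" "a \<in> carrier A" "b \<in> carrier B"
      using x by (auto simp: semidirect_group_def)
    have "\<phi> (inv\<^bsub>B\<^esub> b) (inv\<^bsub>A\<^esub> a) \<otimes>\<^bsub>A\<^esub> \<phi> (inv\<^bsub>B\<^esub> b) a =
        \<phi> (inv\<^bsub>B\<^esub> b) (inv\<^bsub>A\<^esub> a \<otimes>\<^bsub>A\<^esub> a)"
      using ab by (intro ap(2)[symmetric]) simp_all
    also have "\<dots> = \<one>\<^bsub>A\<^esub>"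
      using ab by (simp add: one_A)
    finally have "\<phi> (inv\<^bsub>B\<^esub> b) (inv\<^bsub>A\<^esub> a) \<otimes>\<^bsub>A\<^esub> \<phi> (inv\<^bsub>B\<^esub> b) a = \<one>\<^bsub>A\<^esub>" .
    then show "\<exists>y \<in> carrier (semidirect_group A B \<phi>).
                 y \<otimes>\<^bsub>semidirect_group A B \<phi>\<^esub> x = \<one>\<^bsub>semidirect_group A B \<phi>\<^esub>"
      using ab by (intro bexI[of _ "(\<phi> (inv\<^bsub>B\<^esub> b) (inv\<^bsub>A\<^esub> a), inv\<^bsub>B\<^esub> b)"])
        (auto simp: semidirect_group_def ap)
  qed (auto simp: semidirect_group_def ap one_A one_B A.m_assoc B.m_assoc)
qed

lemma coset_incidence_system_semidirect_product:
  assumes \<alpha>: "coset_incidence_system \<alpha>" and \<beta>: "coset_incidence_system \<beta>"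
    and \<phi>: "admissible \<alpha> (grp \<beta>) \<phi>"
  shows "coset_incidence_system (semidirect_product \<alpha> \<beta> \<phi>)"
proof -
  interpret A: group "grp \<alpha>" using \<alpha> by (simp add: coset_incidence_system_def)
  interpret B: group "grp \<beta>" using \<beta> by (simp add: coset_incidence_system_def)
  define G where "G = semidirect_group (grp \<alpha>) (grp \<beta>) \<phi>"
  have carr: "carrier G = carrier (grp \<alpha>) \<times> carrier (grp \<beta>)"
    by (simp add: G_def semidirect_group_def)
  interpret G: group G
    using \<phi> unfolding G_def admissible_def
    by (intro group_semidirect_group A.group_axioms B.group_axioms) simp
  have sub_B: "sub \<beta> i \<subseteq> carrier (grp \<beta>)" if "i \<in> types \<beta>" for i
    using \<beta> that by (auto simp: coset_incidence_system_def dest: subgroup.subset)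
  have sub_A: "orbit_sub \<alpha> k \<subseteq> carrier (grp \<alpha>)" if k: "k \<in> type_orbits \<alpha> (grp \<beta>) \<phi>" for k
  proof -
    obtain i where i: "i \<in> types \<alpha>" "k = type_orbit \<alpha> (grp \<beta>) \<phi> i"
      using k unfolding type_orbits_def by blast
    obtain \<sigma> where \<sigma>: "bij_betw \<sigma> (types \<alpha>) (types \<alpha>)" "\<phi> \<one>\<^bsub>grp \<beta>\<^esub> ` sub \<alpha> i = sub \<alpha> (\<sigma> i)"
      using \<phi> i(1) B.one_closed unfolding admissible_def by metis
    have "\<sigma> i \<in> types \<alpha>"
      using bij_betwE[OF \<sigma>(1)] i(1) by (rule bspec)
    moreover from this have "\<sigma> i \<in> k"
      using \<sigma>(2) B.one_closed unfolding i(2) type_orbit_def by blast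
    ultimately have "orbit_sub \<alpha> k \<subseteq> sub \<alpha> (\<sigma> i)" and "subgroup (sub \<alpha> (\<sigma> i)) (grp \<alpha>)"
      using \<alpha> unfolding orbit_sub_def coset_incidence_system_def by blast+
    then show ?thesis
      by (blast dest: subgroup.subset)
  qed
  have "subgroup (sub (semidirect_product \<alpha> \<beta> \<phi>) t) G"
    if "t \<in> types (semidirect_product \<alpha> \<beta> \<phi>)" for t
    using that B.one_closed A.one_closed
    by (cases t)
      (auto simp: semidirect_product_def Let_def G_def[symmetric] carr
        intro!: G.generate_is_subgroup dest: subsetD[OF sub_A] subsetD[OF sub_B])
  then show ?thesis
    using G.group_axioms
    by (simp add: coset_incidence_system_def semidirect_product_def Let_def G_def)
qed

end

theory Submission
  imports Defs
begin

text \<open>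
  Every flag type \<open>J\<close> carries the standard flag of the subgroups \<open>G\<^sub>i\<close> (\<open>i \<in> J\<close>), so
  flag-transitivity says exactly that the cosets of each flag have a common element. In
  \<open>A \<rtimes> B\<close> the cosets of type \<open>i \<in> I\<^sub>\<beta>\<close> are \<open>A \<times> bB\<^sub>i\<close> and those of type \<open>k \<in> K\<close> are
  \<open>aA\<^sub>k \<times> B\<close>, because \<open>A\<^sub>k\<close> is \<open>B\<close>-invariant. For a flag, the \<open>bB\<^sub>i\<close> form a flag of \<open>\<beta>\<close>,
  and replacing each \<open>aA\<^sub>k\<close> by all \<open>aA\<^sub>i\<close> with \<open>i \<in> k\<close> gives a flag of \<open>\<alpha>\<close>; common elements
  of these two flags form a pair lying in every coset of the original flag.
\<close>

section \<open>Flag-transitivity as existence of a common element\<close>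

lemma flag_transitive_iff_common_element:
  assumes "coset_incidence_system \<alpha>"
  shows "flag_transitive \<alpha> \<longleftrightarrow>
    (\<forall>F. flag \<alpha> F \<longrightarrow> (\<exists>g \<in> carrier (grp \<alpha>). \<forall>x \<in> F. g \<in> snd x))"
    (is "_ \<longleftrightarrow> ?common")
proof -
  interpret group "grp \<alpha>"
    using assms by (simp add: coset_incidence_system_def)
  have sub: "subgroup (sub \<alpha> i) (grp \<alpha>)" if "i \<in> types \<alpha>" for i
    using assms that by (simp add: coset_incidence_system_def)
  show ?thesis
  proof
    assume trans: "flag_transitive \<alpha>"
    show ?common
    proof (intro allI impI)
      fix F assume F: "flag \<alpha> F"
      \<comment> \<open>All members of \<open>F0\<close> contain the identity, so \<open>F0\<close>
        is a flag, of the same type as \<open>F\<close>. An element \<open>g\<close> that carries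
        \<open>F0\<close> to \<open>F\<close> sends the identity to \<open>g\<close>, which
        therefore lies in every member of \<open>F\<close>.\<close>
      define F0 where "F0 = (\<lambda>i. (i, sub \<alpha> i)) ` flag_type F"
      have J: "flag_type F \<subseteq> types \<alpha>"
        using F by (auto simp: flag_def elements_def flag_type_def)
      have std: "sub \<alpha> i \<in> lcosets\<^bsub>grp \<alpha>\<^esub> sub \<alpha> i" "\<one>\<^bsub>grp \<alpha>\<^esub> \<in> sub \<alpha> i"
        if "i \<in> flag_type F" for i
      proof -
        have H: "subgroup (sub \<alpha> i) (grp \<alpha>)"
          using sub J that by blast
        show "\<one>\<^bsub>grp \<alpha>\<^esub> \<in> sub \<alpha> i"
          using H by (rule subgroup.one_closed)
        show "sub \<alpha> i \<in> lcosets\<^bsub>grp \<alpha>\<^esub> sub \<alpha> i"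
          using lcos_mult_one[OF subgroup.subset[OF H]] one_closed unfolding LCOSETS_def by blast
      qed
      have "flag \<alpha> F0"
        using J std unfolding flag_def elements_def F0_def incident_def by fastforce
      moreover have "flag_type F0 = flag_type F"
        by (force simp: F0_def flag_type_def)
      ultimately obtain g where g: "g \<in> carrier (grp \<alpha>)" "translate \<alpha> g ` F0 = F"
        using trans F J unfolding flag_transitive_def by metis
      have "g \<in> snd x" if "x \<in> F" for x
      proof -
        have "x \<in> translate \<alpha> g ` F0"
          using that g(2) by simp
        then obtain i where "i \<in> flag_type F" "x = (i, g <#\<^bsub>grp \<alpha>\<^esub> sub \<alpha> i)"
          by (auto simp: F0_def translate_def)
        then show ?thesis
          using lcos_self[OF g(1) sub] J by auto
      qed
      then show "\<exists>g \<in> carrier (grp \<alpha>). \<forall>x \<in> F. g \<in> snd x"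
        using g(1) by blast
    qed
  next
    assume common: ?common
    \<comment> \<open>A left coset that contains \<open>g\<close> is the translate by
      \<open>g\<close> of its subgroup, so a flag with common element \<open>g\<close> is the
      standard flag of its type translated by \<open>g\<close>.\<close>
    have eq: "\<exists>g \<in> carrier (grp \<alpha>). F = (\<lambda>i. (i, g <#\<^bsub>grp \<alpha>\<^esub> sub \<alpha> i)) ` flag_type F"
      if F: "flag \<alpha> F" for F
    proof -
      obtain g where g: "g \<in> carrier (grp \<alpha>)" "\<forall>x \<in> F. g \<in> snd x"
        using common F by blast
      have "x = (fst x, g <#\<^bsub>grp \<alpha>\<^esub> sub \<alpha> (fst x))" if x: "x \<in> F" for x
      proof -
        have "fst x \<in> types \<alpha>" "snd x \<in> lcosets\<^bsub>grp \<alpha>\<^esub> sub \<alpha> (fst x)"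
          using F x by (auto simp: flag_def elements_def)
        then show ?thesis
          using g x l_repr_independence[OF _ _ sub, of g] by (auto simp: LCOSETS_def prod_eq_iff)
      qed
      then show ?thesis
        using g(1) unfolding flag_type_def image_image
        by (intro bexI[of _ g]) (metis (no_types, lifting) image_cong image_ident)
    qed
    show "flag_transitive \<alpha>"
      unfolding flag_transitive_def
    proof (intro allI impI, elim conjE)
      fix J F F'
      assume J: "J \<subseteq> types \<alpha>" and F: "flag \<alpha> F" "flag_type F = J" and F': "flag \<alpha> F'" "flag_type F' = J"
      obtain g where g: "g \<in> carrier (grp \<alpha>)" "F = (\<lambda>i. (i, g <#\<^bsub>grp \<alpha>\<^esub> sub \<alpha> i)) ` J"
        using eq[OF F(1)] F(2) by auto
      obtain g' where g': "g' \<in> carrier (grp \<alpha>)" "F' = (\<lambda>i. (i, g' <#\<^bsub>grp \<alpha>\<^esub> sub \<alpha> i)) ` J"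
        using eq[OF F'(1)] F'(2) by auto
      \<comment> \<open>The inverse of \<open>g\<close> takes \<open>F\<close> back to the standard
        flag of type \<open>J\<close>, and \<open>g'\<close> takes that flag to
        \<open>F'\<close>.\<close>
      define h where "h = g' \<otimes>\<^bsub>grp \<alpha>\<^esub> inv\<^bsub>grp \<alpha>\<^esub> g"
      have h: "h \<in> carrier (grp \<alpha>)" "h \<otimes>\<^bsub>grp \<alpha>\<^esub> g = g'"
        using g(1) g'(1) by (simp_all add: h_def m_assoc)
      have "h <#\<^bsub>grp \<alpha>\<^esub> (g <#\<^bsub>grp \<alpha>\<^esub> sub \<alpha> i) = g' <#\<^bsub>grp \<alpha>\<^esub> sub \<alpha> i" if "i \<in> J" for i
        using lcos_m_assoc[OF subgroup.subset[OF sub] h(1) g(1)] that J h(2) by auto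
      then have "translate \<alpha> h ` F = F'"
        unfolding g(2) g'(2) image_image translate_def by (intro image_cong) simp_all
      then show "\<exists>g \<in> carrier (grp \<alpha>). translate \<alpha> g ` F = F'"
        using h(1) by blast
    qed
  qed
qed

section \<open>Subgroups and cosets of product form in the semi-direct product\<close>

locale semidirect = A: group A + B: group B
  for A :: "'a monoid" and B :: "'b monoid" and \<phi> :: "'b \<Rightarrow> 'a \<Rightarrow> 'a" +
  assumes hom: "\<phi> \<in> hom B (AutoGroup A)"
begin

abbreviation "G \<equiv> semidirect_group A B \<phi>"

sublocale G: group G
  using A.group_axioms B.group_axioms hom by (rule group_semidirect_group)

lemmas act = auto_hom_apply[OF hom]

lemma act_one: "b \<in> carrier B \<Longrightarrow> \<phi> b \<one>\<^bsub>A\<^esub> = \<one>\<^bsub>A\<^esub>"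
  using act(2)[of b "\<one>\<^bsub>A\<^esub>" "\<one>\<^bsub>A\<^esub>"] act(1)[of b "\<one>\<^bsub>A\<^esub>"] by simp

lemma one_act:
  assumes "a \<in> carrier A"
  shows "\<phi> \<one>\<^bsub>B\<^esub> a = a"
proof -
  have "group_hom B (AutoGroup A) \<phi>"
    by (simp add: group_hom_def group_hom_axioms_def hom A.AutoGroup B.group_axioms)
  then have "\<phi> \<one>\<^bsub>B\<^esub> = \<one>\<^bsub>AutoGroup A\<^esub>"
    by (rule group_hom.hom_one)
  with assms show ?thesis
    by (simp add: AutoGroup_def BijGroup_def)
qed

lemma inv_act:
  assumes "a \<in> carrier A" "b \<in> carrier B"
  shows "\<phi> b (\<phi> (inv\<^bsub>B\<^esub> b) a) = a"
  using act(3)[of b "inv\<^bsub>B\<^esub> b" a] assms by (simp add: one_act)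

lemma carrier_G: "carrier G = carrier A \<times> carrier B"
  by (simp add: semidirect_group_def)

lemma mult_G: "(a, b) \<otimes>\<^bsub>G\<^esub> (a', b') = (a \<otimes>\<^bsub>A\<^esub> \<phi> b a', b \<otimes>\<^bsub>B\<^esub> b')"
  by (simp add: semidirect_group_def)

lemma one_G: "\<one>\<^bsub>G\<^esub> = (\<one>\<^bsub>A\<^esub>, \<one>\<^bsub>B\<^esub>)"
  by (simp add: semidirect_group_def)

text \<open>The first coordinate of a product is \<open>h \<otimes> \<phi> k h'\<close>, and that of
  the inverse of \<open>(h, k)\<close> is \<open>\<phi>\<close> of the inverse of \<open>k\<close>
  applied to the inverse of \<open>h\<close>. Invariance of \<open>H\<close> keeps both in
  \<open>H\<close>.\<close>

lemma subgroup_Times: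
  assumes H: "subgroup H A" and K: "subgroup K B"
    and inv: "\<And>b h. b \<in> carrier B \<Longrightarrow> h \<in> H \<Longrightarrow> \<phi> b h \<in> H"
  shows "subgroup (H \<times> K) G"
proof (rule G.subgroupI)
  interpret H: subgroup H A by fact
  interpret K: subgroup K B by fact
  show "H \<times> K \<subseteq> carrier G"
    using H.subset K.subset by (auto simp: carrier_G)
  show "H \<times> K \<noteq> {}"
    using H.one_closed K.one_closed by blast
  fix x assume x: "x \<in> H \<times> K"
  then obtain h k where hk: "x = (h, k)" "h \<in> H" "k \<in> K" by blast
  have "(\<phi> (inv\<^bsub>B\<^esub> k) (inv\<^bsub>A\<^esub> h), inv\<^bsub>B\<^esub> k) \<otimes>\<^bsub>G\<^esub> x = \<one>\<^bsub>G\<^esub>"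
    using hk act(2)[of "inv\<^bsub>B\<^esub> k" "inv\<^bsub>A\<^esub> h" h] by (simp add: mult_G one_G act_one)
  then have "inv\<^bsub>G\<^esub> x = (\<phi> (inv\<^bsub>B\<^esub> k) (inv\<^bsub>A\<^esub> h), inv\<^bsub>B\<^esub> k)"
    using hk by (intro G.inv_equality) (simp_all add: carrier_G act)
  then show "inv\<^bsub>G\<^esub> x \<in> H \<times> K"
    using hk inv by simp
  fix y assume "y \<in> H \<times> K"
  then show "x \<otimes>\<^bsub>G\<^esub> y \<in> H \<times> K"
    using hk inv by (auto simp: mult_G)
qed

text \<open>Each pair factors as \<open>(h, k) = (h, 1) (1, k)\<close>. This turns the generated
  subgroups of the semi-direct product into explicit products: \<open>H\<close> is all of
  \<open>A\<close> for types from \<beta>, and \<open>K\<close> is all of \<open>B\<close> for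
  orbits.\<close>

lemma generate_Times:
  assumes H: "subgroup H A" and K: "subgroup K B"
    and inv: "\<And>b h. b \<in> carrier B \<Longrightarrow> h \<in> H \<Longrightarrow> \<phi> b h \<in> H"
  shows "generate G (H \<times> {\<one>\<^bsub>B\<^esub>} \<union> {\<one>\<^bsub>A\<^esub>} \<times> K) = H \<times> K"
proof
  interpret H: subgroup H A by fact
  interpret K: subgroup K B by fact
  show "generate G (H \<times> {\<one>\<^bsub>B\<^esub>} \<union> {\<one>\<^bsub>A\<^esub>} \<times> K) \<subseteq> H \<times> K"
    using assms by (intro G.generate_subgroup_incl subgroup_Times) auto
  show "H \<times> K \<subseteq> generate G (H \<times> {\<one>\<^bsub>B\<^esub>} \<union> {\<one>\<^bsub>A\<^esub>} \<times> K)"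
  proof clarify
    fix h k assume hk: "h \<in> H" "k \<in> K"
    have "(h, \<one>\<^bsub>B\<^esub>) \<otimes>\<^bsub>G\<^esub> (\<one>\<^bsub>A\<^esub>, k) \<in> generate G (H \<times> {\<one>\<^bsub>B\<^esub>} \<union> {\<one>\<^bsub>A\<^esub>} \<times> K)"
      using hk by (intro generate.eng generate.incl) auto
    then show "(h, k) \<in> generate G (H \<times> {\<one>\<^bsub>B\<^esub>} \<union> {\<one>\<^bsub>A\<^esub>} \<times> K)"
      using hk by (simp add: mult_G act_one)
  qed
qed

lemma l_coset_Times:
  assumes H: "subgroup H A" and K: "subgroup K B"
    and inv: "\<And>b h. b \<in> carrier B \<Longrightarrow> h \<in> H \<Longrightarrow> \<phi> b h \<in> H"
    and b: "b \<in> carrier B"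
  shows "(a, b) <#\<^bsub>G\<^esub> (H \<times> K) = (a <#\<^bsub>A\<^esub> H) \<times> (b <#\<^bsub>B\<^esub> K)"
proof -
  have "\<phi> b ` H = H"
  proof
    show "\<phi> b ` H \<subseteq> H"
      using inv b by blast
    show "H \<subseteq> \<phi> b ` H"
      using inv b inv_act subgroup.mem_carrier[OF H] by (metis B.inv_closed image_eqI subsetI)
  qed
  then have "a <#\<^bsub>A\<^esub> H = a <#\<^bsub>A\<^esub> (\<phi> b ` H)"
    by (rule arg_cong[OF sym])
  also have "\<dots> = (\<Union>h \<in> H. {a \<otimes>\<^bsub>A\<^esub> \<phi> b h})"
    by (simp add: l_coset_def)
  finally show ?thesis
    by (auto simp: l_coset_def mult_G)
qed

end

section \<open>The subgroups attached to orbits\<close>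

text \<open>Each element of \<open>B\<close> maps the subgroups with index in the orbit
  \<open>k\<close> to one another, hence preserves their intersection.\<close>

lemma admissible_type_orbit:
  assumes \<alpha>: "coset_incidence_system \<alpha>" and B: "group B" and \<phi>: "admissible \<alpha> B \<phi>"
    and k: "k \<in> type_orbits \<alpha> B \<phi>"
  shows "k \<subseteq> types \<alpha>" and "subgroup (orbit_sub \<alpha> k) (grp \<alpha>)"
    and "\<And>b x. b \<in> carrier B \<Longrightarrow> x \<in> orbit_sub \<alpha> k \<Longrightarrow> \<phi> b x \<in> orbit_sub \<alpha> k"
proof -
  interpret semidirect "grp \<alpha>" B \<phi>
    using \<alpha> B \<phi> by (simp add: semidirect_def semidirect_axioms_def admissible_def coset_incidence_system_def)
  have sub: "subgroup (sub \<alpha> i) (grp \<alpha>)" if "i \<in> types \<alpha>" for i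
    using \<alpha> that by (simp add: coset_incidence_system_def)
  note memA = subgroup.mem_carrier[OF sub]
  obtain i0 where i0: "i0 \<in> types \<alpha>" "k = type_orbit \<alpha> B \<phi> i0"
    using k unfolding type_orbits_def by blast
  show k_types: "k \<subseteq> types \<alpha>"
    unfolding i0 type_orbit_def by blast
  \<comment> \<open>This puts \<open>i0\<close> into its own orbit. Nonemptiness of \<open>k\<close>
    matters, since an intersection over the empty set would be the whole type and not a
    subgroup.\<close>
  have "\<phi> \<one>\<^bsub>B\<^esub> ` sub \<alpha> i0 = sub \<alpha> i0"
    using i0(1) memA one_act by force
  then have "i0 \<in> k"
    using i0 unfolding type_orbit_def by (auto intro!: bexI[of _ "\<one>\<^bsub>B\<^esub>"])
  then show "subgroup (orbit_sub \<alpha> k) (grp \<alpha>)"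
    unfolding orbit_sub_def using k_types sub by (intro A.subgroups_Inter) auto
  fix b x assume b: "b \<in> carrier B" and x: "x \<in> orbit_sub \<alpha> k"
  show "\<phi> b x \<in> orbit_sub \<alpha> k"
    unfolding orbit_sub_def
  proof
    fix i assume i: "i \<in> k"
    then obtain c where c: "c \<in> carrier B" "\<phi> c ` sub \<alpha> i0 = sub \<alpha> i"
      unfolding i0 type_orbit_def by blast
    \<comment> \<open>The subgroup with index \<open>j\<close> is the preimage of
      \<open>sub \<alpha> i\<close> under \<open>\<phi> b\<close>. Once \<open>j\<close> is known to
      lie in \<open>k\<close>, the element \<open>x\<close> belongs to this preimage, so
      \<open>\<phi> b x\<close> is in \<open>sub \<alpha> i\<close>.\<close>
    obtain j where j: "j \<in> types \<alpha>" "\<phi> (inv\<^bsub>B\<^esub> b) ` sub \<alpha> i = sub \<alpha> j"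
      using \<phi> b i k_types unfolding admissible_def by (meson B.inv_closed bij_betwE subsetD)
    have "\<phi> (inv\<^bsub>B\<^esub> b \<otimes>\<^bsub>B\<^esub> c) ` sub \<alpha> i0 = \<phi> (inv\<^bsub>B\<^esub> b) ` \<phi> c ` sub \<alpha> i0"
      unfolding image_image using b c(1) memA[OF i0(1)] by (intro image_cong) (auto simp: act)
    then have "j \<in> k"
      using b c j unfolding i0 type_orbit_def by auto
    then have "x \<in> \<phi> (inv\<^bsub>B\<^esub> b) ` sub \<alpha> i"
      using x j by (auto simp: orbit_sub_def)
    then show "\<phi> b x \<in> sub \<alpha> i"
      using inv_act b i k_types memA by auto
  qed
qed

section \<open>A common element for each flag of the semi-direct product\<close>

theorem proposition4p4:
  fixes \<alpha> :: "('a, 'i) coset_system" and \<beta> :: "('b, 'j) coset_system"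
    and \<phi> :: "'b \<Rightarrow> 'a \<Rightarrow> 'a"
  assumes "coset_incidence_system \<alpha>" and "coset_incidence_system \<beta>"
    and "admissible \<alpha> (grp \<beta>) \<phi>"
    and "flag_transitive \<alpha>" and "flag_transitive \<beta>"
  shows "flag_transitive (semidirect_product \<alpha> \<beta> \<phi>)"
proof -
  let ?A = "grp \<alpha>" and ?B = "grp \<beta>" and ?S = "semidirect_product \<alpha> \<beta> \<phi>"
  interpret semidirect ?A ?B \<phi>
    using assms(1-3)
    by (simp add: semidirect_def semidirect_axioms_def admissible_def coset_incidence_system_def)
  note orb = admissible_type_orbit[OF assms(1) B.group_axioms assms(3)]
  have subA: "subgroup (sub \<alpha> i) ?A" if "i \<in> types \<alpha>" for i
    using assms(1) that by (simp add: coset_incidence_system_def)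
  have subB: "subgroup (sub \<beta> j) ?B" if "j \<in> types \<beta>" for j
    using assms(2) that by (simp add: coset_incidence_system_def)
  have grp_S: "grp ?S = G" and types_S: "types ?S = types \<beta> <+> type_orbits \<alpha> ?B \<phi>"
    by (simp_all add: semidirect_product_def Let_def)
  have sub_Inl: "sub ?S (Inl j) = carrier ?A \<times> sub \<beta> j" if "j \<in> types \<beta>" for j
    using generate_Times[OF A.subgroup_self subB[OF that]] act(1)
    by (simp add: semidirect_product_def Let_def)
  have sub_Inr: "sub ?S (Inr k) = orbit_sub \<alpha> k \<times> carrier ?B" if "k \<in> type_orbits \<alpha> ?B \<phi>" for k
    using generate_Times[OF orb(2)[OF that] B.subgroup_self] orb(3)[OF that]
    by (simp add: semidirect_product_def Let_def)
  have "\<exists>g \<in> carrier (grp ?S). \<forall>x \<in> F. g \<in> snd x" if F: "flag ?S F" for F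
  proof -
    have el: "t \<in> types ?S" "\<exists>a \<in> carrier ?A. \<exists>b \<in> carrier ?B. C = (a, b) <#\<^bsub>G\<^esub> sub ?S t"
      if "(t, C) \<in> F" for t C
      using F that unfolding flag_def elements_def LCOSETS_def grp_S carrier_G by blast+
    have meet: "C \<inter> D \<noteq> {}" if "(t, C) \<in> F" "(u, D) \<in> F" for t u C D
      proof -
      have "incident (t, C) (u, D)"
        using F that unfolding flag_def by blast
      then show ?thesis
        by (simp add: incident_def)
    qed
    \<comment> \<open>The coset of \<open>carrier ?A\<close> by \<open>a\<close> is
      \<open>carrier ?A\<close> itself, so only the \<open>B\<close>-part of the representative
      survives. For orbits the roles of the two factors are exchanged.\<close>
    have Inl: "j \<in> types \<beta> \<and> (\<exists>b \<in> carrier ?B. C = carrier ?A \<times> (b <#\<^bsub>?B\<^esub> sub \<beta> j))"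
      if mem: "(Inl j, C) \<in> F" for j C
    proof -
      have j: "j \<in> types \<beta>"
        using el(1)[OF mem] by (auto simp: types_S)
      obtain a b where ab: "a \<in> carrier ?A" "b \<in> carrier ?B" "C = (a, b) <#\<^bsub>G\<^esub> sub ?S (Inl j)"
        using el(2)[OF mem] by blast
      have "C = (a <#\<^bsub>?A\<^esub> carrier ?A) \<times> (b <#\<^bsub>?B\<^esub> sub \<beta> j)"
        unfolding ab(3) sub_Inl[OF j]
        using A.subgroup_self subB[OF j] act(1) ab(2) by (rule l_coset_Times)
      then show ?thesis
        using j ab A.coset_join3[OF _ A.subgroup_self] by auto
    qed
    have Inr: "k \<in> type_orbits \<alpha> ?B \<phi> \<and>
        (\<exists>a \<in> carrier ?A. C = (a <#\<^bsub>?A\<^esub> orbit_sub \<alpha> k) \<times> carrier ?B)"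
      if mem: "(Inr k, C) \<in> F" for k C
    proof -
      have k: "k \<in> type_orbits \<alpha> ?B \<phi>"
        using el(1)[OF mem] by (auto simp: types_S)
      obtain a b where ab: "a \<in> carrier ?A" "b \<in> carrier ?B" "C = (a, b) <#\<^bsub>G\<^esub> sub ?S (Inr k)"
        using el(2)[OF mem] by blast
      have "C = (a <#\<^bsub>?A\<^esub> orbit_sub \<alpha> k) \<times> (b <#\<^bsub>?B\<^esub> carrier ?B)"
        unfolding ab(3) sub_Inr[OF k]
        using orb(2)[OF k] B.subgroup_self orb(3)[OF k] ab(2) by (rule l_coset_Times)
      then show ?thesis
        using k ab B.coset_join3[OF _ B.subgroup_self] by auto
    qed
    \<comment> \<open>As \<open>A\<close> is nonempty, the second projection recovers the coset in
      \<open>B\<close> from its product with \<open>A\<close>. It also sends a common point of two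
      members of \<open>F\<close> to a common point of their images.\<close>
    define F\<^sub>\<beta> where "F\<^sub>\<beta> = {(j, snd ` C) | j C. (Inl j, C) \<in> F}"
    have "flag \<beta> F\<^sub>\<beta>"
      unfolding flag_def
    proof (intro conjI subsetI ballI)
      fix x assume "x \<in> F\<^sub>\<beta>"
      then obtain j C where jC: "x = (j, snd ` C)" "(Inl j, C) \<in> F"
        unfolding F\<^sub>\<beta>_def by blast
      obtain b where b: "b \<in> carrier ?B" "C = carrier ?A \<times> (b <#\<^bsub>?B\<^esub> sub \<beta> j)"
        using Inl[OF jC(2)] by blast
      have "snd ` C = b <#\<^bsub>?B\<^esub> sub \<beta> j"
        unfolding b(2) using A.one_closed by (subst snd_image_times) auto
      then show "x \<in> elements \<beta>"
        using Inl[OF jC(2)] b(1) by (auto simp: jC(1) elements_def LCOSETS_def)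
    next
      fix x y assume "x \<in> F\<^sub>\<beta>" "y \<in> F\<^sub>\<beta>"
      then show "incident x y"
        unfolding F\<^sub>\<beta>_def incident_def using meet by fastforce
    qed
    then obtain b where b: "b \<in> carrier ?B" "\<forall>x \<in> F\<^sub>\<beta>. b \<in> snd x"
      using flag_transitive_iff_common_element[OF assms(2)] assms(5) by blast
    define F\<^sub>\<alpha> where "F\<^sub>\<alpha> = {(i, a <#\<^bsub>?A\<^esub> sub \<alpha> i) | i k a.
      i \<in> k \<and> a \<in> carrier ?A \<and> (Inr k, (a <#\<^bsub>?A\<^esub> orbit_sub \<alpha> k) \<times> carrier ?B) \<in> F}"
    have "flag \<alpha> F\<^sub>\<alpha>"
      unfolding flag_def
    proof (intro conjI subsetI ballI)
      fix x assume "x \<in> F\<^sub>\<alpha>"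
      then show "x \<in> elements \<alpha>"
        unfolding F\<^sub>\<alpha>_def elements_def LCOSETS_def using Inr orb(1) by blast
    next
      fix x y assume "x \<in> F\<^sub>\<alpha>" "y \<in> F\<^sub>\<alpha>"
      then obtain i k a i' k' a' where
        x: "x = (i, a <#\<^bsub>?A\<^esub> sub \<alpha> i)" "i \<in> k" "(Inr k, (a <#\<^bsub>?A\<^esub> orbit_sub \<alpha> k) \<times> carrier ?B) \<in> F"
        and y: "y = (i', a' <#\<^bsub>?A\<^esub> sub \<alpha> i')" "i' \<in> k'"
          "(Inr k', (a' <#\<^bsub>?A\<^esub> orbit_sub \<alpha> k') \<times> carrier ?B) \<in> F"
        unfolding F\<^sub>\<alpha>_def by blast
      have "(a <#\<^bsub>?A\<^esub> orbit_sub \<alpha> k) \<inter> (a' <#\<^bsub>?A\<^esub> orbit_sub \<alpha> k') \<noteq> {}"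
        using meet[OF x(3) y(3)] by blast
      moreover have "a <#\<^bsub>?A\<^esub> orbit_sub \<alpha> k \<subseteq> snd x" "a' <#\<^bsub>?A\<^esub> orbit_sub \<alpha> k' \<subseteq> snd y"
        using x(1,2) y(1,2) by (auto simp: l_coset_def orbit_sub_def)
      ultimately show "incident x y"
        unfolding incident_def by blast
    qed
    then obtain a where a: "a \<in> carrier ?A" "\<forall>x \<in> F\<^sub>\<alpha>. a \<in> snd x"
      using flag_transitive_iff_common_element[OF assms(1)] assms(4) by blast
    have "(a, b) \<in> C" if x: "(t, C) \<in> F" for t C
    proof (cases t)
      case t: (Inl j)
      have "(j, snd ` C) \<in> F\<^sub>\<beta>"
        using x t unfolding F\<^sub>\<beta>_def by blast
      then have "b \<in> snd ` C"
        using b(2) by force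
      moreover obtain b' where "C = carrier ?A \<times> (b' <#\<^bsub>?B\<^esub> sub \<beta> j)"
        using Inl x t by blast
      ultimately show ?thesis
        using a(1) by (auto split: if_splits)
    next
      case t: (Inr k)
      obtain a' where a': "a' \<in> carrier ?A" "C = (a' <#\<^bsub>?A\<^esub> orbit_sub \<alpha> k) \<times> carrier ?B"
        using Inr x t by blast
      have k: "k \<in> type_orbits \<alpha> ?B \<phi>"
        using Inr x t by blast
      \<comment> \<open>The representative \<open>a'\<close> is the same for all \<open>i\<close> in
        \<open>k\<close>. Hence the single quotient of \<open>a\<close> by \<open>a'\<close> lies in
        every \<open>sub \<alpha> i\<close>, thus in their intersection, and \<open>a\<close> lies
        in the coset of \<open>orbit_sub \<alpha> k\<close> by \<open>a'\<close>.\<close>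
      have "inv\<^bsub>?A\<^esub> a' \<otimes>\<^bsub>?A\<^esub> a \<in> sub \<alpha> i" if i: "i \<in> k" for i
      proof -
        have "(i, a' <#\<^bsub>?A\<^esub> sub \<alpha> i) \<in> F\<^sub>\<alpha>"
          using i a' x t unfolding F\<^sub>\<alpha>_def by blast
        then have "a \<in> a' <#\<^bsub>?A\<^esub> sub \<alpha> i"
          using a(2) by force
        then obtain h where h: "h \<in> sub \<alpha> i" "a = a' \<otimes>\<^bsub>?A\<^esub> h"
          unfolding l_coset_def by blast
        moreover have "h \<in> carrier ?A"
          using h(1) subgroup.mem_carrier[OF subA] orb(1)[OF k] i by blast
        ultimately show ?thesis
          using a'(1) by (simp add: A.m_assoc[symmetric])
      qed
      then have "inv\<^bsub>?A\<^esub> a' \<otimes>\<^bsub>?A\<^esub> a \<in> orbit_sub \<alpha> k"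
        by (simp add: orbit_sub_def)
      moreover have "a = a' \<otimes>\<^bsub>?A\<^esub> (inv\<^bsub>?A\<^esub> a' \<otimes>\<^bsub>?A\<^esub> a)"
        using a(1) a'(1) by (simp add: A.m_assoc[symmetric])
      ultimately show ?thesis
        using a'(2) b(1) unfolding l_coset_def by blast
    qed
    then show ?thesis
      using a(1) b(1) by (intro bexI[of _ "(a, b)"]) (auto simp: grp_S carrier_G)
  qed
  then show ?thesis
    using flag_transitive_iff_common_element[OF coset_incidence_system_semidirect_product[OF assms(1-3)]]
    by blast
qed

end
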